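(* Let $n\ge 0$ be an integer, let $D$ be a flat virtual knot diagram with a nonempty vertex set $V=V_{flat}\cup V_{fake}$, choose a starting arc of $(D,V)$, and let $A$ be the associated $k\times k$ coloring matrix with entries in $\mathcal{S}_n$. Then the $(k,k)$-quasideterminant $|A|_{k,k}\in\mathcal{S}_n$ can be defined, and $\pi_{0,n}(|A|_{k,k})=0$.
   Context: Ring. For a non-negative integer $n$, $\mathcal{S}_n$ is the unital ring $\mathbb{Z}\langle s,\overline{s},t\rangle/I_n$, where $I_n$ is the two-sided ideal generated by $s\overline{s}-1$, $\overline{s}s-1$, $ts-s\sum_{i=1}^{n}t^{i}$, $t\overline{s}-\overline{s}\sum_{i=1}^{n}(-1)^{i-1}t^{i}$ and $t^{n+1}$; the image of $\overline{s}$ is written $s^{-1}$. $\mathcal{S}_0=\mathbb{Z}[s^{\pm1}]$, and $\pi_{0,n}:\mathcal{S}_n\to\mathcal{S}_0$ is the ring homomorphism with $s\mapsto s$, $t\mapsto 0$. Quasideterminant. For an $m\times m$ matrix $A$ over a ring, let $A^{i,j}$ be $A$ with row $i$ and column $j$ deleted, $r_i^{j}(A)$ the $i$-th row with its $j$-th entry deleted, $c^{i}_{j}(A)$ the $j$-th column with its $i$-th entry deleted. If $m=1$, $|A|_{1,1}=(A)_{1,1}$. If $m>1$ and $A^{i,j}$ is invertible, $|A|_{i,j}=(A)_{i,j}-r_i^{j}(A)(A^{i,j})^{-1}c^{i}_{j}(A)$; otherwise $|A|_{i,j}$ is not defined. Diagrams. A flat virtual knot diagram is a generic immersion of an oriented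 circle $S^1$ into $\mathbb{R}^2$ (finitely many multiple points, all transversal double points), each double point being labeled "flat" or "virtual". $V_{flat}$ is the set of flat crossings, and $V_{fake}$ is a (possibly empty) finite set of points of the image that are not double points, called fake vertices; $V=V_{flat}\cup V_{fake}$ is assumed nonempty. The preimage of $V$ cuts $S^1$ into $k$ components, whose images are called the arcs of $(D,V)$ (virtual crossings do not cut arcs). Coloring matrix. Choose a starting arc, label it $1$, and label the other arcs $2,\dots,k$ in order along the orientation; the arc with index $0$ means arc $k$. Let $e_1,\dots,e_k$ be the standard row vectors. At each flat crossing with velocity vectors of its two strands $v_1,v_2$, name the strands so that $(v_1,v_2)$ is a positively oriented basis of $\mathbb{R}^2$. The $i$-th row of $A$ is determined by the vertex at the initial point of arc $i$: (a) if it is a flat crossing and arcs $i-1,i$ lie (before and after the crossing) on its strand 2, the row is $e_i-s\,e_{i-1}-t\,e_j$, where $j$ is the label of the arc entering the crossing along strand 1; (b) if it is a flat crossing and arcs $i-1,i$ lie on its strand 1, the row is $e_i-s^{-1}(1-t^2)\,e_{i-1}+s^{-1}ts\,e_j$, where $j$ is the label of the arc entering the crossing along strand 2; (c) if it is a fake vertex, the row is $e_i-e_{i-1}$ (zero if $k=1$). Coefficients are added when indices coincide. *)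

theory Defs
  imports
    "HOL-Analysis.Analysis"
    "HOL-Algebra.QuotRing"
    "HOL-Library.Poly_Mapping"
begin

section \<open>The rings\<close>

text \<open>
  The free unital ring on three non-commuting letters is the monoid ring of the free monoid:
  finitely supported integer-valued functions on words, with convolution as product. Words are
  written additively because multiplication on \<^typ>\<open>'a \<Rightarrow>\<^sub>0 'b\<close> convolves along \<open>(+)\<close>.
\<close>

datatype letter = S_letter | S_bar_letter | T_letter

datatype word = Word (letters: "letter list")

instantiation word :: monoid_add
begin

definition zero_word :: word where
  "0 = Word []"

definition plus_word :: "word \<Rightarrow> word \<Rightarrow> word" where
  "u + v = Word (letters u @ letters v)"

instance
  by standard (simp_all add: zero_word_def plus_word_def)

end

type_synonym free_ring_elem = "word \<Rightarrow>\<^sub>0 int"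

definition free_letter :: "letter \<Rightarrow> free_ring_elem" where
  "free_letter a = Poly_Mapping.single (Word [a]) 1"

abbreviation free_s :: free_ring_elem where "free_s \<equiv> free_letter S_letter"
abbreviation free_s_bar :: free_ring_elem where "free_s_bar \<equiv> free_letter S_bar_letter"
abbreviation free_t :: free_ring_elem where "free_t \<equiv> free_letter T_letter"

definition free_ring :: "free_ring_elem ring" where
  "free_ring = \<lparr>carrier = UNIV, monoid.mult = (*), one = 1, ring.zero = 0, add = (+)\<rparr>"

definition S_relators :: "nat \<Rightarrow> free_ring_elem set" where
  "S_relators n =
    {free_s * free_s_bar - 1,
     free_s_bar * free_s - 1,
     free_t * free_s - free_s * (\<Sum>i=1..n. free_t ^ i),
     free_t * free_s_bar - free_s_bar * (\<Sum>i=1..n. (-1) ^ (i - 1) * free_t ^ i),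
     free_t ^ (n + 1)}"

definition S_ideal :: "nat \<Rightarrow> free_ring_elem set" where
  "S_ideal n = Idl\<^bsub>free_ring\<^esub> (S_relators n)"

definition S_ring :: "nat \<Rightarrow> free_ring_elem set ring" where
  "S_ring n = free_ring Quot S_ideal n"

definition S_class :: "nat \<Rightarrow> free_ring_elem \<Rightarrow> free_ring_elem set" where
  "S_class n x = S_ideal n +>\<^bsub>free_ring\<^esub> x"

abbreviation s_elem :: "nat \<Rightarrow> free_ring_elem set" where
  "s_elem n \<equiv> S_class n free_s"
abbreviation s_inv_elem :: "nat \<Rightarrow> free_ring_elem set" where
  "s_inv_elem n \<equiv> S_class n free_s_bar"
abbreviation t_elem :: "nat \<Rightarrow> free_ring_elem set" where
  "t_elem n \<equiv> S_class n free_t"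

text \<open>
  The projection to \<^term>\<open>S_ring 0\<close>, in which \<open>t\<close> is zero. Functions in HOL are total, so it is
  made unique by being \<^const>\<open>undefined\<close> off the carrier; existence and uniqueness are proved in
  \<open>S_proj_unique\<close> below, and the values in \<open>S_proj_S_class\<close>.
\<close>

definition is_S_proj :: "nat \<Rightarrow> (free_ring_elem set \<Rightarrow> free_ring_elem set) \<Rightarrow> bool" where
  "is_S_proj n h \<longleftrightarrow>
     h \<in> ring_hom (S_ring n) (S_ring 0) \<and> h \<in> extensional (carrier (S_ring n)) \<and>
     h (s_elem n) = s_elem 0 \<and> h (t_elem n) = \<zero>\<^bsub>S_ring 0\<^esub>"

definition S_proj :: "nat \<Rightarrow> free_ring_elem set \<Rightarrow> free_ring_elem set" where
  "S_proj n = (THE h. is_S_proj n h)"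

lemma free_ring_simps [simp]:
  "carrier free_ring = UNIV" "x \<otimes>\<^bsub>free_ring\<^esub> y = x * y" "\<one>\<^bsub>free_ring\<^esub> = 1"
  "\<zero>\<^bsub>free_ring\<^esub> = 0" "x \<oplus>\<^bsub>free_ring\<^esub> y = x + y"
  by (simp_all add: free_ring_def)

lemma ring_free_ring: "ring free_ring"
proof -
  have "\<exists>y. x + y = 0" for x :: free_ring_elem
    using add.right_inverse by blast
  moreover have "\<exists>y. y + x = 0" for x :: free_ring_elem
    using add.left_inverse by blast
  ultimately show ?thesis
    unfolding free_ring_def
    by unfold_locales (auto simp: algebra_simps Units_def)
qed

lemma free_ring_minus [simp]: "x \<ominus>\<^bsub>free_ring\<^esub> y = x - y"
proof -
  interpret ring free_ring by (rule ring_free_ring)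
  have "\<ominus>\<^bsub>free_ring\<^esub> y = - y"
    using minus_equality[of "- y" y] by simp
  then show ?thesis by (simp add: a_minus_def)
qed

lemma ideal_S_ideal: "ideal (S_ideal n) free_ring"
  unfolding S_ideal_def by (rule ring.genideal_ideal[OF ring_free_ring]) simp

lemma S_relators_in_ideal: "S_relators n \<subseteq> S_ideal n"
  unfolding S_ideal_def by (rule ring.genideal_self[OF ring_free_ring]) simp

lemma ring_S_ring: "ring (S_ring n)"
  unfolding S_ring_def by (rule ideal.quotient_is_ring[OF ideal_S_ideal])

lemma S_class_hom: "S_class n \<in> ring_hom free_ring (S_ring n)"
  using ideal.rcos_ring_hom[OF ideal_S_ideal] unfolding S_class_def[abs_def] S_ring_def by simp

lemma S_class_closed [simp]: "S_class n x \<in> carrier (S_ring n)"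
  using ring_hom_closed[OF S_class_hom] by simp

lemma S_class_mult: "S_class n x \<otimes>\<^bsub>S_ring n\<^esub> S_class n y = S_class n (x * y)"
  using ring_hom_mult[OF S_class_hom] by simp

lemma S_class_add: "S_class n x \<oplus>\<^bsub>S_ring n\<^esub> S_class n y = S_class n (x + y)"
  using ring_hom_add[OF S_class_hom] by simp

lemma S_class_one: "S_class n 1 = \<one>\<^bsub>S_ring n\<^esub>"
  using ring_hom_one[OF S_class_hom] by simp

lemma S_class_eq_iff: "S_class n x = S_class n y \<longleftrightarrow> x - y \<in> S_ideal n"
proof -
  interpret ideal "S_ideal n" free_ring by (rule ideal_S_ideal)
  show ?thesis
    using quotient_eq_iff_same_a_r_cos[OF ideal_S_ideal, of x y] by (simp add: S_class_def)
qed

lemma S_class_zero: "S_class n 0 = \<zero>\<^bsub>S_ring n\<^esub>"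
  using ring_hom_zero[OF S_class_hom ring_free_ring ring_S_ring] by simp

lemma S_carrier_cases:
  assumes "X \<in> carrier (S_ring n)"
  obtains x where "X = S_class n x"
  using assms unfolding S_ring_def S_class_def FactRing_def A_RCOSETS_def'
  by auto

lemma t_elem_0: "t_elem 0 = \<zero>\<^bsub>S_ring 0\<^esub>"
proof -
  have "free_t \<in> S_ideal 0"
    using S_relators_in_ideal[of 0] by (auto simp: S_relators_def)
  then show ?thesis by (simp flip: S_class_zero add: S_class_eq_iff)
qed

lemma S_ideal_le_0: "S_ideal n \<subseteq> S_ideal 0"
proof -
  interpret I: ideal "S_ideal 0" free_ring by (rule ideal_S_ideal)
  have rel: "S_relators 0 \<subseteq> S_ideal 0" by (rule S_relators_in_ideal)
  then have t: "free_t \<in> S_ideal 0" by (auto simp: S_relators_def)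
  have l: "x * a \<in> S_ideal 0" and r: "a * x \<in> S_ideal 0" if "a \<in> S_ideal 0" for a x
    using I.I_l_closed[OF that, of x] I.I_r_closed[OF that, of x] by simp_all
  have add: "a + b \<in> S_ideal 0" if "a \<in> S_ideal 0" "b \<in> S_ideal 0" for a b
    using additive_subgroup.a_closed[OF I.is_additive_subgroup that] by simp
  have zero: "0 \<in> S_ideal 0" using additive_subgroup.zero_closed[OF I.is_additive_subgroup] by simp
  have diff: "a - b \<in> S_ideal 0" if "a \<in> S_ideal 0" "b \<in> S_ideal 0" for a b
    using add[OF that(1) l[OF that(2), of "- 1"]] by simp
  have pow: "free_t ^ i \<in> S_ideal 0" if "i \<ge> 1" for i
    using that r[OF t] by (cases i) auto
  have sum: "(\<Sum>i=1..n. f i) \<in> S_ideal 0" if "\<And>i. i \<ge> 1 \<Longrightarrow> f i \<in> S_ideal 0" for f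
    using that add zero by (induction n) auto
  have "free_s * free_s_bar - 1 \<in> S_ideal 0" "free_s_bar * free_s - 1 \<in> S_ideal 0"
    using rel by (auto simp: S_relators_def)
  moreover have "free_s * (\<Sum>i=1..n. free_t ^ i) \<in> S_ideal 0"
    by (rule l[OF sum[OF pow]])
  moreover have "free_s_bar * (\<Sum>i=1..n. (-1) ^ (i - 1) * free_t ^ i) \<in> S_ideal 0"
    by (rule l[OF sum[OF l[OF pow]]])
  ultimately have "S_relators n \<subseteq> S_ideal 0"
    unfolding S_relators_def insert_subset
    by (intro conjI empty_subsetI diff[OF r[OF t]] pow) simp_all
  then show ?thesis
    unfolding S_ideal_def[of n]
    by (rule ring.genideal_minimal[OF ring_free_ring ideal_S_ideal])
qed

lemma S_class_hom_ext:
  assumes f: "f \<in> ring_hom free_ring (S_ring 0)" and g: "g \<in> ring_hom free_ring (S_ring 0)"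
    and letters: "\<And>a. f (free_letter a) = g (free_letter a)"
  shows "f x = g x"
proof -
  interpret R: ring "S_ring 0" by (rule ring_S_ring)
  have word: "f (Poly_Mapping.single (Word w) 1) = g (Poly_Mapping.single (Word w) 1)" for w
  proof (induction w)
    case Nil
    have "Poly_Mapping.single (Word []) (1::int) = 1"
      by (metis single_one zero_word_def)
    then show ?case using ring_hom_one[OF f] ring_hom_one[OF g] by simp
  next
    case (Cons a w)
    have "Poly_Mapping.single (Word (a # w)) (1::int)
        = free_letter a * Poly_Mapping.single (Word w) 1"
      by (simp add: free_letter_def mult_single plus_word_def)
    then show ?case
      using Cons.IH letters[of a] ring_hom_mult[OF f] ring_hom_mult[OF g] by simp
  qed
  have add: "f (a + b) = g (a + b)" if "f a = g a" "f b = g b" for a b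
    using that ring_hom_add[OF f, of a b] ring_hom_add[OF g, of a b] by simp
  have zero: "f 0 = g 0"
    using ring_hom_zero[OF f ring_free_ring ring_S_ring]
      ring_hom_zero[OF g ring_free_ring ring_S_ring] by simp
  have uminus: "f (- a) = g (- a)" if "f a = g a" for a
  proof -
    have cl: "f b \<in> carrier (S_ring 0)" "g b \<in> carrier (S_ring 0)" for b
      using ring_hom_closed[OF f] ring_hom_closed[OF g] by auto
    have "f (- a) \<oplus>\<^bsub>S_ring 0\<^esub> f a = f 0" "g (- a) \<oplus>\<^bsub>S_ring 0\<^esub> g a = g 0"
      using ring_hom_add[OF f, of "- a" a] ring_hom_add[OF g, of "- a" a] by simp_all
    then have "\<ominus>\<^bsub>S_ring 0\<^esub> f a = f (- a)" "\<ominus>\<^bsub>S_ring 0\<^esub> g a = g (- a)"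
      unfolding ring_hom_zero[OF f ring_free_ring ring_S_ring, simplified]
        ring_hom_zero[OF g ring_free_ring ring_S_ring, simplified]
      using R.minus_equality[OF _ cl(1) cl(1)] R.minus_equality[OF _ cl(2) cl(2)] by blast+
    then show ?thesis using that by simp
  qed
  have single: "f (Poly_Mapping.single w c) = g (Poly_Mapping.single w c)" for w c
  proof (induction c rule: int_induct[where k = 0])
    case base
    then show ?case using zero by simp
  next
    case (step1 i)
    then show ?case using word[of "letters w"] add by (simp add: single_add)
  next
    case (step2 i)
    then show ?case using word[of "letters w"] add uminus
      by (simp add: diff_conv_add_uminus single_add single_uminus del: add_uminus_conv_diff)
  qed
  show ?thesis
  proof (induction x rule: update_induct)
    case const
    show ?case by (rule zero)
  next
    case (update h a b)
    have "Poly_Mapping.update a b h = Poly_Mapping.single a b + h"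
      using update.hyps
      by (intro poly_mapping_eqI)
         (auto simp: lookup_update lookup_add lookup_single when_def in_keys_iff)
    then show ?case using add single update.IH by simp
  qed
qed

lemma s_inv_unique:
  assumes "Y \<in> carrier (S_ring n)" "s_elem n \<otimes>\<^bsub>S_ring n\<^esub> Y = \<one>\<^bsub>S_ring n\<^esub>"
  shows "Y = s_inv_elem n"
proof -
  interpret R: ring "S_ring n" by (rule ring_S_ring)
  have "free_s_bar * free_s - 1 \<in> S_ideal n"
    using S_relators_in_ideal[of n] by (auto simp: S_relators_def)
  then have inv: "s_inv_elem n \<otimes>\<^bsub>S_ring n\<^esub> s_elem n = \<one>\<^bsub>S_ring n\<^esub>"
    by (simp flip: S_class_one add: S_class_mult S_class_eq_iff)
  have "Y = (s_inv_elem n \<otimes>\<^bsub>S_ring n\<^esub> s_elem n) \<otimes>\<^bsub>S_ring n\<^esub> Y"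
    using assms inv by simp
  also have "\<dots> = s_inv_elem n"
    using assms by (simp add: R.m_assoc)
  finally show ?thesis .
qed

lemma is_S_proj_S_class:
  assumes "is_S_proj n h"
  shows "h (S_class n x) = S_class 0 x"
proof -
  have h: "h \<in> ring_hom (S_ring n) (S_ring 0)" using assms by (simp add: is_S_proj_def)
  have comp: "h \<circ> S_class n \<in> ring_hom free_ring (S_ring 0)"
    by (rule ring_hom_trans[OF S_class_hom h])
  have "free_s * free_s_bar - 1 \<in> S_ideal n"
    using S_relators_in_ideal[of n] by (auto simp: S_relators_def)
  then have "s_elem n \<otimes>\<^bsub>S_ring n\<^esub> s_inv_elem n = \<one>\<^bsub>S_ring n\<^esub>"
    by (simp flip: S_class_one add: S_class_mult S_class_eq_iff)
  then have "h (s_elem n) \<otimes>\<^bsub>S_ring 0\<^esub> h (s_inv_elem n) = \<one>\<^bsub>S_ring 0\<^esub>"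
    using ring_hom_mult[OF h, of "s_elem n" "s_inv_elem n"] ring_hom_one[OF h] by simp
  then have "h (s_inv_elem n) = s_inv_elem 0"
    using assms ring_hom_closed[OF h] by (intro s_inv_unique) (simp_all add: is_S_proj_def)
  then have "(h \<circ> S_class n) (free_letter a) = S_class 0 (free_letter a)" for a
    using assms t_elem_0 by (cases a) (simp_all add: is_S_proj_def)
  from S_class_hom_ext[OF comp S_class_hom this] show ?thesis by simp
qed

lemma S_proj_exists: "\<exists>h. is_S_proj n h"
proof -
  define h where
    "h = restrict (\<lambda>X. S_class 0 (SOME x. X = S_class n x)) (carrier (S_ring n))"
  have val: "h (S_class n x) = S_class 0 x" for x
  proof -
    have "S_class n x = S_class n (SOME y. S_class n x = S_class n y)"
      by (rule someI[where P = "\<lambda>y. S_class n x = S_class n y" and x = x]) (rule refl)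
    then have "S_class 0 x = S_class 0 (SOME y. S_class n x = S_class n y)"
      using S_ideal_le_0[of n] unfolding S_class_eq_iff by (rule rev_subsetD)
    then show ?thesis by (simp add: h_def)
  qed
  have "h \<in> ring_hom (S_ring n) (S_ring 0)"
  proof (rule ring_hom_memI)
    fix X Y assume "X \<in> carrier (S_ring n)" "Y \<in> carrier (S_ring n)"
    then obtain x y where "X = S_class n x" "Y = S_class n y"
      by (elim S_carrier_cases)
    then show "h (X \<otimes>\<^bsub>S_ring n\<^esub> Y) = h X \<otimes>\<^bsub>S_ring 0\<^esub> h Y"
      "h (X \<oplus>\<^bsub>S_ring n\<^esub> Y) = h X \<oplus>\<^bsub>S_ring 0\<^esub> h Y"
      by (simp_all add: S_class_mult S_class_add val)
  next
    fix X assume "X \<in> carrier (S_ring n)"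
    then show "h X \<in> carrier (S_ring 0)" by (elim S_carrier_cases) (simp add: val)
  next
    show "h \<one>\<^bsub>S_ring n\<^esub> = \<one>\<^bsub>S_ring 0\<^esub>" by (simp flip: S_class_one add: val)
  qed
  moreover have "h \<in> extensional (carrier (S_ring n))" by (simp add: h_def)
  ultimately show ?thesis using t_elem_0 val unfolding is_S_proj_def by auto
qed

lemma S_proj_unique: "\<exists>!h. is_S_proj n h"
proof (rule ex_ex1I[OF S_proj_exists])
  fix g h assume gh: "is_S_proj n g" "is_S_proj n h"
  show "g = h"
  proof (rule extensionalityI[of _ "carrier (S_ring n)"])
    show "g \<in> extensional (carrier (S_ring n))" "h \<in> extensional (carrier (S_ring n))"
      using gh by (simp_all add: is_S_proj_def)
    fix X assume "X \<in> carrier (S_ring n)"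
    then show "g X = h X"
      using gh by (elim S_carrier_cases) (simp add: is_S_proj_S_class)
  qed
qed

lemma is_S_proj_S_proj: "is_S_proj n (S_proj n)"
  unfolding S_proj_def by (rule theI'[OF S_proj_unique])

lemma S_proj_S_class: "S_proj n (S_class n x) = S_class 0 x"
  by (rule is_S_proj_S_class[OF is_S_proj_S_proj])


section \<open>Quasideterminants\<close>

text \<open>
  Matrices are functions of a row and a column index. A matrix with some rows and columns deleted
  keeps the labels of the remaining ones, so it is the same function considered on smaller index
  sets. The inverse of a matrix with rows \<open>I\<close> and columns \<open>J\<close> has rows \<open>J\<close> and columns \<open>I\<close>.
\<close>

definition is_matrix_inverse ::
    "('a, 'b) ring_scheme \<Rightarrow> nat set \<Rightarrow> nat set \<Rightarrow> (nat \<Rightarrow> nat \<Rightarrow> 'a) \<Rightarrow> (nat \<Rightarrow> nat \<Rightarrow> 'a) \<Rightarrow> bool" where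
  "is_matrix_inverse R I J A B \<longleftrightarrow>
     (\<forall>q\<in>J. \<forall>p\<in>I. B q p \<in> carrier R) \<and>
     (\<forall>p\<in>I. \<forall>p'\<in>I. (\<Oplus>\<^bsub>R\<^esub>q\<in>J. A p q \<otimes>\<^bsub>R\<^esub> B q p') = (if p = p' then \<one>\<^bsub>R\<^esub> else \<zero>\<^bsub>R\<^esub>)) \<and>
     (\<forall>q\<in>J. \<forall>q'\<in>J. (\<Oplus>\<^bsub>R\<^esub>p\<in>I. B q p \<otimes>\<^bsub>R\<^esub> A p q') = (if q = q' then \<one>\<^bsub>R\<^esub> else \<zero>\<^bsub>R\<^esub>))"

text \<open>
  \<^const>\<open>None\<close> means that the quasideterminant is not defined. The choice of \<open>B\<close> is harmless:
  its entries with row in \<open>J\<close> and column in \<open>I\<close> are unique, and no other entries are used.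
\<close>

definition quasideterminant ::
    "('a, 'b) ring_scheme \<Rightarrow> nat \<Rightarrow> (nat \<Rightarrow> nat \<Rightarrow> 'a) \<Rightarrow> nat \<Rightarrow> nat \<Rightarrow> 'a option" where
  "quasideterminant R m A i j =
    (let I = {1..m} - {i}; J = {1..m} - {j} in
     if m = 1 then Some (A i j)
     else if \<exists>B. is_matrix_inverse R I J A B then
       (let B = (SOME B. is_matrix_inverse R I J A B)
        in Some (A i j \<ominus>\<^bsub>R\<^esub>
             (\<Oplus>\<^bsub>R\<^esub>q\<in>J. \<Oplus>\<^bsub>R\<^esub>p\<in>I. A i q \<otimes>\<^bsub>R\<^esub> B q p \<otimes>\<^bsub>R\<^esub> A p j)))
     else None)"


section \<open>Flat virtual knot diagrams\<close>

text \<open>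
  The oriented circle is \<open>\<real>/\<int>\<close> with the direction of increasing parameter, so a map from the circle
  to the plane is a function on the reals of period 1, and \<open>{0..<1}\<close> lists each point of the circle
  once. Immersions are only required to be continuously differentiable, which includes smooth ones.
\<close>

definition velocity :: "(real \<Rightarrow> real^2) \<Rightarrow> real \<Rightarrow> real^2" where
  "velocity \<gamma> x = vector_derivative \<gamma> (at x)"

definition closed_immersion :: "(real \<Rightarrow> real^2) \<Rightarrow> bool" where
  "closed_immersion \<gamma> \<longleftrightarrow>
     (\<forall>x. \<gamma> (x + 1) = \<gamma> x) \<and> \<gamma> C1_differentiable_on UNIV \<and>
     (\<forall>x. velocity \<gamma> x \<noteq> 0)"

definition circle_fibre :: "(real \<Rightarrow> real^2) \<Rightarrow> real^2 \<Rightarrow> real set" where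
  "circle_fibre \<gamma> p = {x \<in> {0..<1}. \<gamma> x = p}"

definition multiple_points :: "(real \<Rightarrow> real^2) \<Rightarrow> (real^2) set" where
  "multiple_points \<gamma> = {p. \<exists>x\<in>circle_fibre \<gamma> p. \<exists>y\<in>circle_fibre \<gamma> p. x \<noteq> y}"

definition generic_immersion :: "(real \<Rightarrow> real^2) \<Rightarrow> bool" where
  "generic_immersion \<gamma> \<longleftrightarrow>
     closed_immersion \<gamma> \<and> finite (multiple_points \<gamma>) \<and>
     (\<forall>p\<in>multiple_points \<gamma>.
        card (circle_fibre \<gamma> p) = 2 \<and>
        (\<forall>x\<in>circle_fibre \<gamma> p. \<forall>y\<in>circle_fibre \<gamma> p.
           x \<noteq> y \<longrightarrow> span {velocity \<gamma> x, velocity \<gamma> y} = UNIV))"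

text \<open>\<open>F\<close> is the set of flat crossings; the double points outside \<open>F\<close> are the virtual ones.\<close>

definition flat_virtual_knot_diagram :: "(real \<Rightarrow> real^2) \<Rightarrow> (real^2) set \<Rightarrow> bool" where
  "flat_virtual_knot_diagram \<gamma> F \<longleftrightarrow> generic_immersion \<gamma> \<and> F \<subseteq> multiple_points \<gamma>"

definition fake_vertices :: "(real \<Rightarrow> real^2) \<Rightarrow> (real^2) set \<Rightarrow> bool" where
  "fake_vertices \<gamma> W \<longleftrightarrow> finite W \<and> W \<subseteq> range \<gamma> - multiple_points \<gamma>"

text \<open>
  The components into which the preimage of \<open>V\<close> cuts the circle, lifted to the real line, are open
  intervals. A labelling \<open>c\<close> lists the components met in one period, starting with an arbitrary
  one: the arc labelled \<open>i \<in> {1..k}\<close> is traversed by the parameters from \<open>c i\<close> to \<open>c (i + 1)\<close>.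
\<close>

definition arc_labelling ::
    "(real \<Rightarrow> real^2) \<Rightarrow> (real^2) set \<Rightarrow> nat \<Rightarrow> (nat \<Rightarrow> real) \<Rightarrow> bool" where
  "arc_labelling \<gamma> V k c \<longleftrightarrow>
     k \<ge> 1 \<and>
     (\<forall>i\<in>{1..k}. c i < c (i + 1) \<and> {c i<..<c (i + 1)} \<in> components (UNIV - \<gamma> -` V)) \<and>
     c (k + 1) = c 1 + 1"


text \<open>Any vertex parameter can be chosen as the initial point of the arc labelled 1:\<close>

lemma closed_immersion_add_int:
  assumes "closed_immersion \<gamma>"
  shows "\<gamma> (x + of_int m) = \<gamma> x"
proof (induction m rule: int_induct[where k = 0])
  case base
  then show ?case by simp
next
  case (step1 i)
  have "\<gamma> (x + of_int i + 1) = \<gamma> (x + of_int i)"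
    using assms unfolding closed_immersion_def by blast
  then show ?case using step1 by (simp add: add.assoc)
next
  case (step2 i)
  have "\<gamma> ((x + of_int (i - 1)) + 1) = \<gamma> (x + of_int (i - 1))"
    using assms unfolding closed_immersion_def by blast
  then show ?case using step2 by simp
qed

lemma finite_circle_fibre:
  assumes "generic_immersion \<gamma>"
  shows "finite (circle_fibre \<gamma> p)"
proof (cases "p \<in> multiple_points \<gamma>")
  case True
  then have "card (circle_fibre \<gamma> p) = 2"
    using assms by (simp add: generic_immersion_def)
  then show ?thesis by (simp add: card_ge_0_finite)
next
  case False
  then have "x = y" if "x \<in> circle_fibre \<gamma> p" "y \<in> circle_fibre \<gamma> p" for x y
    using that unfolding multiple_points_def by blast
  then have "circle_fibre \<gamma> p \<subseteq> {x}" if "x \<in> circle_fibre \<gamma> p" for x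
    using that by blast
  then show ?thesis using finite_subset by (metis equals0I finite.emptyI finite_insert)
qed

lemma finite_cut_parameters:
  assumes "generic_immersion \<gamma>" "finite V"
  shows "finite (\<gamma> -` V \<inter> {a..<a + 1})"
proof -
  have cl: "closed_immersion \<gamma>" using assms by (simp add: generic_immersion_def)
  have "frac ` (\<gamma> -` V \<inter> {a..<a + 1}) \<subseteq> (\<Union>p\<in>V. circle_fibre \<gamma> p)"
  proof (rule image_subsetI)
    fix x assume x: "x \<in> \<gamma> -` V \<inter> {a..<a + 1}"
    have "\<gamma> (frac x) = \<gamma> x"
      using closed_immersion_add_int[OF cl, of "frac x" "\<lfloor>x\<rfloor>"] by (simp add: frac_def)
    then show "frac x \<in> (\<Union>p\<in>V. circle_fibre \<gamma> p)"
      using x by (auto simp: circle_fibre_def frac_lt_1)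
  qed
  moreover have "finite (\<Union>p\<in>V. circle_fibre \<gamma> p)"
    using assms finite_circle_fibre by blast
  ultimately have "finite (frac ` (\<gamma> -` V \<inter> {a..<a + 1}))"
    by (rule finite_subset)
  moreover have "inj_on frac (\<gamma> -` V \<inter> {a..<a + 1})"
  proof (rule inj_onI)
    fix x y
    assume xy: "x \<in> \<gamma> -` V \<inter> {a..<a + 1}" "y \<in> \<gamma> -` V \<inter> {a..<a + 1}" "frac x = frac y"
    then have eq: "x - y = of_int (\<lfloor>x\<rfloor> - \<lfloor>y\<rfloor>)" by (simp add: frac_def algebra_simps)
    moreover have "\<bar>x - y\<bar> < 1" using xy by auto
    ultimately have "\<bar>\<lfloor>x\<rfloor> - \<lfloor>y\<rfloor>\<bar> < 1"
      by (metis of_int_abs of_int_less_1_iff)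
    then show "x = y" using eq by simp
  qed
  ultimately show ?thesis by (rule finite_imageD)
qed

lemma greaterThanLessThan_in_components:
  fixes a b :: real
  assumes "a < b" "a \<in> P" "b \<in> P" "{a<..<b} \<inter> P = {}"
  shows "{a<..<b} \<in> components (UNIV - P)"
proof -
  have "D = {a<..<b}"
    if D: "D \<noteq> {}" "D \<subseteq> UNIV - P" "{a<..<b} \<subseteq> D" "connected D" for D
  proof (rule ccontr)
    assume "D \<noteq> {a<..<b}"
    then obtain y where y: "y \<in> D" "y \<le> a \<or> y \<ge> b" using D(3) by force
    have m: "(a + b) / 2 \<in> D" using D(3) assms(1) by (auto simp: subset_iff field_simps)
    have "a \<in> D \<or> b \<in> D"
      using y connectedD_interval[OF D(4) y(1) m] connectedD_interval[OF D(4) m y(1)] assms(1)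
      by (auto simp: field_simps)
    then show False using D(2) assms by auto
  qed
  then show ?thesis
    unfolding in_components_maximal using assms by (auto simp: connected_Ioo)
qed

lemma arc_labelling_exists:
  assumes D: "flat_virtual_knot_diagram \<gamma> F" and W: "fake_vertices \<gamma> W"
    and a: "\<gamma> a \<in> F \<union> W"
  shows "\<exists>k c. arc_labelling \<gamma> (F \<union> W) k c \<and> c 1 = a"
proof -
  define P where "P = \<gamma> -` (F \<union> W)"
  define B where "B = P \<inter> {a..<a + 1}"
  have gen: "generic_immersion \<gamma>" using D by (simp add: flat_virtual_knot_diagram_def)
  then have cl: "closed_immersion \<gamma>" by (simp add: generic_immersion_def)
  have "finite F"
    using D gen finite_subset unfolding flat_virtual_knot_diagram_def generic_immersion_def by blast
  then have "finite (F \<union> W)" using W by (simp add: fake_vertices_def)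
  then have fin: "finite B" unfolding B_def P_def by (rule finite_cut_parameters[OF gen])
  have aP: "a \<in> P" using a by (simp add: P_def)
  then have aB: "a \<in> B" by (simp add: B_def)
  define xs where "xs = sorted_list_of_set B"
  define k where "k = length xs"
  define c where "c = (\<lambda>i. if i \<le> k then xs ! (i - 1) else a + 1)"
  have set: "set xs = B" and sorted: "sorted xs" and dist: "distinct xs"
    using fin by (simp_all add: xs_def)
  have k: "k \<ge> 1" using aB set by (auto simp: k_def Suc_le_eq)
  have inB: "xs ! m \<in> B" if "m < k" for m using that set by (auto simp: k_def)
  have mono: "xs ! l < xs ! m \<longleftrightarrow> l < m" if "l < k" "m < k" for l m
    using that sorted dist strict_sorted_iff[of xs]
    by (metis k_def linorder_neqE_nat not_less_iff_gr_or_eq sorted_wrt_nth_less)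
  obtain m0 where m0: "m0 < k" "xs ! m0 = a" using aB set by (metis in_set_conv_nth k_def)
  have "\<not> xs ! 0 < xs ! m0" using inB[of 0] k m0 by (auto simp: B_def)
  then have "m0 = 0" using mono[of 0 m0] m0 k by auto
  then have c1: "c 1 = a" using m0 k by (simp add: c_def)
  have ck: "c (k + 1) = a + 1" by (simp add: c_def)
  have "\<gamma> (a + 1) = \<gamma> a" using cl unfolding closed_immersion_def by blast
  then have a1P: "a + 1 \<in> P" using aP by (simp add: P_def)
  have "c i < c (i + 1) \<and> {c i<..<c (i + 1)} \<in> components (UNIV - P)" if i: "i \<in> {1..k}" for i
  proof -
    have ci: "c i = xs ! (i - 1)" "c i \<in> B" using i inB[of "i - 1"] by (auto simp: c_def)
    have lt: "c i < c (i + 1)"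
    proof (cases "i = k")
      case True
      then show ?thesis using ci ck by (auto simp: B_def)
    next
      case False
      then show ?thesis using i mono[of "i - 1" i] by (auto simp: c_def)
    qed
    have le: "c (i + 1) \<le> a + 1"
      using i inB[of i] by (auto simp: c_def B_def)
    have P': "c (i + 1) \<in> P"
      using i inB[of i] a1P by (auto simp: c_def B_def)
    have "{c i<..<c (i + 1)} \<inter> P = {}"
    proof (rule ccontr)
      assume "{c i<..<c (i + 1)} \<inter> P \<noteq> {}"
      then obtain y where y: "c i < y" "y < c (i + 1)" "y \<in> P" by auto
      then have "y \<in> B" using le ci by (auto simp: B_def)
      then obtain m where m: "m < k" "xs ! m = y" using set by (metis in_set_conv_nth k_def)
      have "i - 1 < m" using mono[of "i - 1" m] m i y ci by auto
      then have im: "i \<le> m" by linarith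
      then have "c (i + 1) = xs ! i" using m by (simp add: c_def)
      then show False using mono[of m i] im m y by auto
    qed
    then show ?thesis
      using lt ci P' greaterThanLessThan_in_components[of "c i" "c (i + 1)" P] by (auto simp: B_def)
  qed
  then have "arc_labelling \<gamma> (F \<union> W) k c"
    using k c1 ck unfolding arc_labelling_def P_def by auto
  then show ?thesis using c1 by blast
qed


section \<open>The coloring matrix\<close>

definition positive_basis :: "real^2 \<Rightarrow> real^2 \<Rightarrow> bool" where
  "positive_basis v w \<longleftrightarrow> det (vector [v, w] :: real^2^2) > 0"

definition prev_arc :: "nat \<Rightarrow> nat \<Rightarrow> nat" where
  "prev_arc k i = (if i = 1 then k else i - 1)"

text \<open>
  If arc \<open>i\<close> starts at a flat crossing, exactly two arcs end there: the one before arc \<open>i\<close> on the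
  same strand, and the one entering along the other strand.
\<close>

definition crossing_arc :: "(real \<Rightarrow> real^2) \<Rightarrow> nat \<Rightarrow> (nat \<Rightarrow> real) \<Rightarrow> nat \<Rightarrow> nat" where
  "crossing_arc \<gamma> k c i =
     (THE j. j \<in> {1..k} \<and> j \<noteq> prev_arc k i \<and> \<gamma> (c (j + 1)) = \<gamma> (c i))"

text \<open>
  In the first case the strand of arc \<open>j\<close> is strand 1 and that of arc \<open>i\<close> is strand 2; in the
  second case it is the other way round.
\<close>

definition coloring_matrix ::
    "nat \<Rightarrow> (real \<Rightarrow> real^2) \<Rightarrow> (real^2) set \<Rightarrow> nat \<Rightarrow> (nat \<Rightarrow> real) \<Rightarrow>
     nat \<Rightarrow> nat \<Rightarrow> free_ring_elem set" where
  "coloring_matrix n \<gamma> F k c i q =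
    (let R = S_ring n; s = s_elem n; s' = s_inv_elem n; t = t_elem n;
         e = (\<lambda>a. if a = q then \<one>\<^bsub>R\<^esub> else \<zero>\<^bsub>R\<^esub>);
         h = prev_arc k i; j = crossing_arc \<gamma> k c i
     in if \<gamma> (c i) \<in> F then
          if positive_basis (velocity \<gamma> (c (j + 1))) (velocity \<gamma> (c i))
          then e i \<ominus>\<^bsub>R\<^esub> s \<otimes>\<^bsub>R\<^esub> e h \<ominus>\<^bsub>R\<^esub> t \<otimes>\<^bsub>R\<^esub> e j
          else e i \<ominus>\<^bsub>R\<^esub> s' \<otimes>\<^bsub>R\<^esub> (\<one>\<^bsub>R\<^esub> \<ominus>\<^bsub>R\<^esub> t \<otimes>\<^bsub>R\<^esub> t) \<otimes>\<^bsub>R\<^esub> e h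
                 \<oplus>\<^bsub>R\<^esub> s' \<otimes>\<^bsub>R\<^esub> t \<otimes>\<^bsub>R\<^esub> s \<otimes>\<^bsub>R\<^esub> e j
        else e i \<ominus>\<^bsub>R\<^esub> e h)"

end

theory Submission
  imports Defs
begin

text \<open>
  The relators let \<open>t\<close> be moved to the right past \<open>s\<close> and \<open>s\<inverse>\<close> at the price of a polynomial in
  \<open>t\<close> without constant term, so \<open>t R \<subseteq> R t\<close> for \<open>R = S_ring n\<close>. Hence \<open>R t\<close> is a two-sided ideal, its
  \<open>m\<close>-th power lies in \<open>R t\<^sup>m\<close>, and its \<open>(n + 1)\<close>-st power is zero. Modulo this nilpotent ideal, row \<open>i\<close>
  of the coloring matrix is \<open>e_i - x_i e_(i-1)\<close> with \<open>x_i \<in> {s, s\<inverse>, 1}\<close>, and deleting the last row and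
  column removes the entry of the first row that wraps around to arc \<open>k\<close>. What remains is lower
  unitriangular modulo a nilpotent ideal, hence \<open>1 - M\<close> with \<open>M\<close> nilpotent, and is inverted by
  a finite geometric series (\<open>matrix_power_filtration\<close>, \<open>matrix_inverse_exists\<close>). So the
  quasideterminant is defined.

  Its projection vanishes as soon as the projected matrix kills a column vector \<open>v\<close> with \<open>v_k = 1\<close>
  (\<open>quasideterminant_mem\<close>). The projected equations \<open>v_i = x_i v_(i-1)\<close> force \<open>v_i\<close> to be a power of \<open>s\<close> whose
  exponent changes by \<open>1\<close> when strand 2 of a flat crossing is followed and by \<open>-1\<close> on strand 1. They
  can be solved around the circle because each flat crossing is passed once on either strand, so the
  total exponent is zero (\<open>sum_strand_sign\<close>, \<open>free_coloring_matrix_kernel\<close>).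

  All computations are done with representatives in the free ring, modulo the ideals \<open>S_ideal n\<close> and
  \<open>S_ideal 0\<close>; as the first is contained in the second, an inverse found modulo \<open>S_ideal n\<close> is also an
  inverse after projection.
\<close>

section \<open>Two-sided ideals and filtrations\<close>

locale two_sided_ideal =
  fixes J :: "'a::ring_1 set"
  assumes zero_mem: "0 \<in> J"
    and add_mem: "x \<in> J \<Longrightarrow> y \<in> J \<Longrightarrow> x + y \<in> J"
    and left_mem: "x \<in> J \<Longrightarrow> a * x \<in> J"
    and right_mem: "x \<in> J \<Longrightarrow> x * a \<in> J"
begin

lemma uminus_mem: "x \<in> J \<Longrightarrow> - x \<in> J"
  using left_mem[of x "- 1"] by simp

lemma diff_mem: "x \<in> J \<Longrightarrow> y \<in> J \<Longrightarrow> x - y \<in> J"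
  using add_mem[of x "- y"] uminus_mem[of y] by simp

lemma sum_mem: "(\<And>i. i \<in> A \<Longrightarrow> f i \<in> J) \<Longrightarrow> sum f A \<in> J"
  by (induction A rule: infinite_finite_induct) (auto intro: zero_mem add_mem)

text \<open>
  If \<open>A\<close> kills the column vector with entries \<open>v\<close> on \<open>K\<close> and \<open>1\<close> at \<open>k\<close>, the rows in \<open>K\<close> determine \<open>v\<close> to be
  \<open>- b\<close> times the last column of \<open>A\<close>. Substituting this in row \<open>k\<close> turns the quasideterminant
  into the entry \<open>k\<close> of \<open>A v\<close>. All equations hold modulo \<open>J\<close>.
\<close>

lemma quasideterminant_mem:
  assumes fin: "finite K"
    and kernel: "\<And>p. p \<in> insert k K \<Longrightarrow> (\<Sum>q\<in>K. A p q * v q) + A p k \<in> J"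
    and inverse: "\<And>q q'. q \<in> K \<Longrightarrow> q' \<in> K \<Longrightarrow>
      (\<Sum>p\<in>K. b q p * A p q') - (if q = q' then 1 else 0) \<in> J"
  shows "A k k - (\<Sum>q\<in>K. \<Sum>p\<in>K. A k q * b q p * A p k) \<in> J"
proof -
  \<comment> \<open>\<open>u\<close> is the product of \<open>A\<close> with the vector; \<open>w\<close> measures how far \<open>v\<close> is from the solution given by \<open>b\<close>.\<close>
  define u where "u p = (\<Sum>q\<in>K. A p q * v q) + A p k" for p
  define w where "w q = v q + (\<Sum>p\<in>K. b q p * A p k)" for q
  have w: "w q \<in> J" if q: "q \<in> K" for q
  proof -
    have "(\<Sum>q'\<in>K. ((\<Sum>p\<in>K. b q p * A p q') - (if q = q' then 1 else 0)) * v q')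
        = (\<Sum>q'\<in>K. \<Sum>p\<in>K. b q p * (A p q' * v q')) - v q"
      using fin q
      by (simp add: left_diff_distrib sum_subtractf sum_distrib_right mult.assoc if_distrib[of "\<lambda>x. x * _"]
          cong: if_cong)
    also have "\<dots> = (\<Sum>p\<in>K. b q p * (\<Sum>q'\<in>K. A p q' * v q')) - v q"
      by (subst sum.swap) (simp add: sum_distrib_left)
    finally have "w q = (\<Sum>p\<in>K. b q p * u p)
        - (\<Sum>q'\<in>K. ((\<Sum>p\<in>K. b q p * A p q') - (if q = q' then 1 else 0)) * v q')"
      by (simp add: w_def u_def distrib_left sum.distrib)
    moreover have "(\<Sum>p\<in>K. b q p * u p) \<in> J"
      using kernel by (intro sum_mem left_mem) (simp add: u_def)
    moreover have
      "(\<Sum>q'\<in>K. ((\<Sum>p\<in>K. b q p * A p q') - (if q = q' then 1 else 0)) * v q') \<in> J"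
      by (intro sum_mem right_mem inverse q)
    ultimately show ?thesis by (simp add: diff_mem)
  qed
  have "A k k - (\<Sum>q\<in>K. \<Sum>p\<in>K. A k q * b q p * A p k) = u k - (\<Sum>q\<in>K. A k q * w q)"
    by (simp add: u_def w_def distrib_left sum.distrib sum_distrib_left mult.assoc)
  moreover have "u k \<in> J" using kernel[of k] by (simp add: u_def)
  moreover have "(\<Sum>q\<in>K. A k q * w q) \<in> J" by (intro sum_mem left_mem w)
  ultimately show ?thesis by (simp add: diff_mem)
qed

end

fun matrix_power :: "'i set \<Rightarrow> ('i \<Rightarrow> 'i \<Rightarrow> 'a::semiring_1) \<Rightarrow> nat \<Rightarrow> 'i \<Rightarrow> 'i \<Rightarrow> 'a" where
  "matrix_power K M 0 i j = (if i = j then 1 else 0)"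
| "matrix_power K M (Suc r) i j = (\<Sum>q\<in>K. M i q * matrix_power K M r q j)"

lemma matrix_power_Suc_right:
  assumes "finite K" "i \<in> K" "j \<in> K"
  shows "(\<Sum>q\<in>K. matrix_power K M r i q * M q j) = matrix_power K M (Suc r) i j"
  using assms(2)
proof (induction r arbitrary: i)
  case 0
  then show ?case
    using assms by (simp add: if_distrib[of "\<lambda>x. x * _"] if_distrib[of "\<lambda>x. _ * x"] cong: if_cong)
next
  case (Suc r)
  have "(\<Sum>q\<in>K. matrix_power K M (Suc r) i q * M q j)
      = (\<Sum>l\<in>K. M i l * (\<Sum>q\<in>K. matrix_power K M r l q * M q j))"
    by (simp add: sum_distrib_right sum_distrib_left mult.assoc) (rule sum.swap)
  then show ?case using Suc.IH by simp
qed

lemma geometric_series_inverse: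
  fixes M :: "'i \<Rightarrow> 'i \<Rightarrow> 'a::ring_1" and N :: nat
  assumes "finite K" "i \<in> K" "j \<in> K"
  defines "B \<equiv> \<lambda>i j. \<Sum>r<N. matrix_power K M r i j"
  shows "(\<Sum>q\<in>K. ((if i = q then 1 else 0) - M i q) * B q j)
      = (if i = j then 1 else 0) - matrix_power K M N i j" (is ?right)
    and "(\<Sum>q\<in>K. B i q * ((if q = j then 1 else 0) - M q j))
      = (if i = j then 1 else 0) - matrix_power K M N i j" (is ?left)
proof -
  have tele: "B i j - (\<Sum>r<N. matrix_power K M (Suc r) i j)
      = (if i = j then 1 else 0) - matrix_power K M N i j"
    using sum_lessThan_telescope'[of "\<lambda>r. matrix_power K M r i j" N]
    by (simp add: B_def sum_subtractf del: matrix_power.simps(2))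
  have "(\<Sum>q\<in>K. ((if i = q then 1 else 0) - M i q) * B q j)
      = B i j - (\<Sum>q\<in>K. M i q * B q j)"
    using assms(1,2)
    by (simp add: left_diff_distrib sum_subtractf if_distrib[of "\<lambda>x. x * _"] cong: if_cong)
  also have "(\<Sum>q\<in>K. M i q * B q j) = (\<Sum>r<N. matrix_power K M (Suc r) i j)"
    by (simp add: B_def sum_distrib_left) (rule sum.swap)
  finally show ?right using tele by simp
  have "(\<Sum>q\<in>K. B i q * ((if q = j then 1 else 0) - M q j))
      = B i j - (\<Sum>q\<in>K. B i q * M q j)"
    using assms(1,3)
    by (simp add: right_diff_distrib sum_subtractf if_distrib[of "\<lambda>x. _ * x"] cong: if_cong)
  also have "(\<Sum>q\<in>K. B i q * M q j) = (\<Sum>r<N. \<Sum>q\<in>K. matrix_power K M r i q * M q j)"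
    unfolding B_def sum_distrib_right by (rule sum.swap)
  also have "\<dots> = (\<Sum>r<N. matrix_power K M (Suc r) i j)"
    using matrix_power_Suc_right[OF assms(1-3), of M] by simp
  finally show ?left using tele by simp
qed

text \<open>
  An entry of \<open>M ^ r\<close> is a sum over walks of length \<open>r\<close> from \<open>i\<close> to \<open>j\<close>. A step that is not strictly
  descending contributes a factor in \<open>J 1\<close>. Such a step raises the index by at most \<open>k - 1\<close> and every
  other step lowers it, so a long walk has many of them: with \<open>m\<close> of them, \<open>r \<le> m * k + i - j\<close>.
  The hypothesis on \<open>m\<close> says that \<open>m - 1\<close> of them would violate this bound; its form is preserved
  when the first step of a walk is removed.
\<close>

lemma matrix_power_filtration:
  fixes J :: "nat \<Rightarrow> 'a::ring_1 set"
  assumes J0: "\<And>x. x \<in> J 0"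
    and zero: "\<And>m. 0 \<in> J m"
    and add: "\<And>m x y. x \<in> J m \<Longrightarrow> y \<in> J m \<Longrightarrow> x + y \<in> J m"
    and left: "\<And>m a x. x \<in> J m \<Longrightarrow> a * x \<in> J m"
    and mult: "\<And>m x y. x \<in> J 1 \<Longrightarrow> y \<in> J m \<Longrightarrow> x * y \<in> J (Suc m)"
    and upper: "\<And>i q. i \<in> {1..<k} \<Longrightarrow> q \<in> {1..<k} \<Longrightarrow> i \<le> q \<Longrightarrow> M i q \<in> J 1"
    and "i \<in> {1..<k}" "j \<in> {1..<k}"
    and "m * k + i < k + r + j"
  shows "matrix_power {1..<k} M r i j \<in> J m"
  using assms(7,9)
proof (induction r arbitrary: i m)
  case 0
  show ?case
  proof (cases "i = j")
    case True
    then have "m * k < 1 * k" using 0 by simp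
    then have "m = 0" by (simp only: mult_less_cancel2) simp
    then show ?thesis using J0 by simp
  qed (simp add: zero)
next
  case (Suc r)
  have sum: "sum f A \<in> J m" if "\<And>q. q \<in> A \<Longrightarrow> f q \<in> J m" for f :: "nat \<Rightarrow> 'a" and A
    using that by (induction A rule: infinite_finite_induct) (auto intro: zero add)
  have "M i q * matrix_power {1..<k} M r q j \<in> J m" if q: "q \<in> {1..<k}" for q
  proof (cases "q < i \<or> m = 0")
    case True
    then show ?thesis using J0 left Suc.IH[OF q, of m] Suc.prems(2) by auto
  next
    case False
    then obtain m' where m: "m = Suc m'" by (cases m) auto
    have "m' * k + q < k + r + j" using Suc.prems q m by auto
    then show ?thesis
      using Suc.IH[OF q] mult upper[OF Suc.prems(1) q] False m by auto
  qed
  then show ?case by (auto intro: sum)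
qed

section \<open>The ring as a quotient of the free ring\<close>

lemma two_sided_ideal_S_ideal: "two_sided_ideal (S_ideal n)"
proof -
  interpret I: ideal "S_ideal n" free_ring by (rule ideal_S_ideal)
  show ?thesis
    using I.I_l_closed I.I_r_closed additive_subgroup.a_closed[OF I.is_additive_subgroup]
      additive_subgroup.zero_closed[OF I.is_additive_subgroup]
    by unfold_locales auto
qed

interpretation S_ideal: two_sided_ideal "S_ideal n" for n
  by (rule two_sided_ideal_S_ideal)

lemma S_class_uminus: "\<ominus>\<^bsub>S_ring n\<^esub> S_class n x = S_class n (- x)"
proof -
  interpret R: ring "S_ring n" by (rule ring_S_ring)
  show ?thesis
    by (rule R.minus_equality) (simp_all add: S_class_add S_class_zero)
qed

lemma S_class_diff: "S_class n x \<ominus>\<^bsub>S_ring n\<^esub> S_class n y = S_class n (x - y)"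
  by (simp add: a_minus_def S_class_uminus S_class_add)

lemma S_class_sum:
  assumes "finite K"
  shows "(\<Oplus>\<^bsub>S_ring n\<^esub>q\<in>K. S_class n (f q)) = S_class n (sum f K)"
proof -
  interpret R: ring "S_ring n" by (rule ring_S_ring)
  show ?thesis
    using assms by induction (simp_all add: S_class_zero S_class_add Pi_def)
qed

lemma S_class_finsum:
  assumes "finite K" "\<And>q. q \<in> K \<Longrightarrow> g q = S_class n (f q)"
  shows "(\<Oplus>\<^bsub>S_ring n\<^esub>q\<in>K. g q) = S_class n (sum f K)"
proof -
  interpret R: ring "S_ring n" by (rule ring_S_ring)
  have "(\<Oplus>\<^bsub>S_ring n\<^esub>q\<in>K. g q) = (\<Oplus>\<^bsub>S_ring n\<^esub>q\<in>K. S_class n (f q))"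
    by (rule R.finsum_cong') (auto simp: assms(2))
  then show ?thesis using S_class_sum[OF assms(1)] by simp
qed

text \<open>The letters generate the free ring: a subring that contains them is everything.\<close>

lemma free_ring_induct:
  assumes one: "P 1" and letter: "\<And>a. P (free_letter a)"
    and add: "\<And>x y. P x \<Longrightarrow> P y \<Longrightarrow> P (x + y)" and uminus: "\<And>x. P x \<Longrightarrow> P (- x)"
    and mult: "\<And>x y. P x \<Longrightarrow> P y \<Longrightarrow> P (x * y)"
  shows "P x"
proof -
  have zero: "P 0" using add[OF one uminus[OF one]] by simp
  have word: "P (Poly_Mapping.single (Word w) 1)" for w
  proof (induction w)
    case Nil
    then show ?case using one by (metis single_one zero_word_def)
  next
    case (Cons a w)
    have "Poly_Mapping.single (Word (a # w)) (1::int)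
        = free_letter a * Poly_Mapping.single (Word w) 1"
      by (simp add: free_letter_def mult_single plus_word_def)
    then show ?case using Cons.IH letter mult by simp
  qed
  have single: "P (Poly_Mapping.single w c)" for w c
  proof (induction c rule: int_induct[where k = 0])
    case base
    then show ?case using zero by simp
  next
    case (step1 i)
    then show ?case using word[of "letters w"] add by (simp add: single_add)
  next
    case (step2 i)
    then show ?case using word[of "letters w"] add uminus
      by (simp add: diff_conv_add_uminus single_add single_uminus del: add_uminus_conv_diff)
  qed
  show ?thesis
  proof (induction x rule: update_induct)
    case const
    show ?case by (rule zero)
  next
    case (update h a b)
    have "Poly_Mapping.update a b h = Poly_Mapping.single a b + h"
      using update.hyps
      by (intro poly_mapping_eqI)
         (auto simp: lookup_update lookup_add lookup_single when_def in_keys_iff)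
    then show ?case using add single update.IH by simp
  qed
qed

text \<open>The preimage in the free ring of the left ideal of \<^term>\<open>S_ring n\<close> generated by \<open>t\<^sup>m\<close>.\<close>

definition t_filtration :: "nat \<Rightarrow> nat \<Rightarrow> free_ring_elem set" where
  "t_filtration n m = {x. \<exists>y. x - y * free_t ^ m \<in> S_ideal n}"

lemma S_ideal_subset_t_filtration: "x \<in> S_ideal n \<Longrightarrow> x \<in> t_filtration n m"
  unfolding t_filtration_def by (auto intro: exI[of _ 0])

lemma t_filtration_0: "x \<in> t_filtration n 0"
  unfolding t_filtration_def by (auto intro!: exI[of _ x] S_ideal.zero_mem)

lemma t_filtration_add:
  assumes "x \<in> t_filtration n m" "y \<in> t_filtration n m"
  shows "x + y \<in> t_filtration n m"
proof -
  obtain a b where "x - a * free_t ^ m \<in> S_ideal n" "y - b * free_t ^ m \<in> S_ideal n"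
    using assms by (auto simp: t_filtration_def)
  then have "(x - a * free_t ^ m) + (y - b * free_t ^ m) \<in> S_ideal n"
    by (rule S_ideal.add_mem)
  then have "(x + y) - (a + b) * free_t ^ m \<in> S_ideal n" by (simp add: algebra_simps)
  then show ?thesis by (auto simp: t_filtration_def)
qed

lemma t_filtration_left:
  assumes "x \<in> t_filtration n m"
  shows "a * x \<in> t_filtration n m"
proof -
  obtain b where "x - b * free_t ^ m \<in> S_ideal n"
    using assms by (auto simp: t_filtration_def)
  then have "a * (x - b * free_t ^ m) \<in> S_ideal n" by (rule S_ideal.left_mem)
  then have "a * x - (a * b) * free_t ^ m \<in> S_ideal n" by (simp add: algebra_simps)
  then show ?thesis unfolding t_filtration_def by blast
qed

text \<open>
  The inclusion \<open>t R \<subseteq> R t\<close>. The elements \<open>x\<close> with \<open>t x \<in> R t\<close> form a subring, so letters suffice;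
  for \<open>s\<close> and \<open>s\<inverse>\<close> a relator rewrites \<open>t x\<close> as \<open>x\<close> times a polynomial in \<open>t\<close> whose last factor \<open>t\<close> can be
  split off.
\<close>

lemma t_times_in_t_filtration: "free_t * x \<in> t_filtration n 1"
proof (induction x rule: free_ring_induct)
  case 1
  show ?case by (auto simp: t_filtration_def intro!: exI[of _ 1] S_ideal.zero_mem)
next
  case (2 a)
  have rel: "S_relators n \<subseteq> S_ideal n" by (rule S_relators_in_ideal)
  have pull: "(\<Sum>i=1..n. f i * free_t ^ i) = (\<Sum>i=1..n. f i * free_t ^ (i - 1)) * free_t"
    for f :: "nat \<Rightarrow> free_ring_elem"
    unfolding sum_distrib_right
    by (intro sum.cong) (auto simp: mult.assoc simp flip: power_Suc2)
  show ?case
  proof (cases a)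
    case S_letter
    have "free_t * free_s - free_s * (\<Sum>i=1..n. 1 * free_t ^ i) \<in> S_ideal n"
      using rel by (auto simp: S_relators_def)
    then show ?thesis
      unfolding S_letter pull t_filtration_def mult.assoc[symmetric] by auto
  next
    case S_bar_letter
    have "free_t * free_s_bar - free_s_bar * (\<Sum>i=1..n. (-1) ^ (i - 1) * free_t ^ i) \<in> S_ideal n"
      using rel by (auto simp: S_relators_def)
    then show ?thesis
      unfolding S_bar_letter pull t_filtration_def mult.assoc[symmetric] by auto
  next
    case T_letter
    then show ?thesis
      by (auto simp: t_filtration_def intro!: exI[of _ free_t] S_ideal.zero_mem)
  qed
next
  case (3 x y)
  then show ?case by (simp add: distrib_left t_filtration_add)
next
  case (4 x)
  then show ?case using t_filtration_left[of "free_t * x" n 1 "- 1"] by simp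
next
  case (5 x y)
  then obtain a where a: "free_t * x - a * free_t \<in> S_ideal n"
    by (auto simp: t_filtration_def)
  have "(free_t * x - a * free_t) * y + a * (free_t * y) \<in> t_filtration n 1"
    by (intro t_filtration_add t_filtration_left 5 S_ideal_subset_t_filtration
        S_ideal.right_mem a)
  then show ?case by (simp add: algebra_simps)
qed

text \<open>Here \<open>t R \<subseteq> R t\<close> enters: \<open>(a t) (b t\<^sup>m) = a (t b) t\<^sup>m \<in> R t t\<^sup>m\<close>.\<close>

lemma t_filtration_mult:
  assumes "x \<in> t_filtration n 1" "y \<in> t_filtration n m"
  shows "x * y \<in> t_filtration n (Suc m)"
proof -
  obtain a b where a: "x - a * free_t \<in> S_ideal n" and b: "y - b * free_t ^ m \<in> S_ideal n"
    using assms by (auto simp: t_filtration_def)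
  obtain d where d: "free_t * b - d * free_t \<in> S_ideal n"
    using t_times_in_t_filtration[of b n] by (auto simp: t_filtration_def)
  have "(x - a * free_t) * y + a * free_t * (y - b * free_t ^ m)
      + a * ((free_t * b - d * free_t) * free_t ^ m) \<in> S_ideal n"
    by (intro S_ideal.add_mem S_ideal.left_mem S_ideal.right_mem a b d)
  then have "x * y - (a * d) * free_t ^ Suc m \<in> S_ideal n"
    by (simp add: algebra_simps)
  then show ?thesis unfolding t_filtration_def by blast
qed

lemma t_filtration_nilpotent:
  assumes "x \<in> t_filtration n (n + 1)"
  shows "x \<in> S_ideal n"
proof -
  obtain a where a: "x - a * free_t ^ (n + 1) \<in> S_ideal n"
    using assms by (auto simp: t_filtration_def)
  have "free_t ^ (n + 1) \<in> S_ideal n"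
    using S_relators_in_ideal[of n] by (auto simp: S_relators_def)
  from S_ideal.add_mem[OF a S_ideal.left_mem[OF this, of a]] show ?thesis by simp
qed

lemma matrix_inverse_exists:
  assumes "\<And>i q. i \<in> {1..<k} \<Longrightarrow> q \<in> {1..<k} \<Longrightarrow> i \<le> q \<Longrightarrow>
      (if i = q then 1 else 0) - A i q \<in> t_filtration n 1"
  shows "\<exists>B. is_matrix_inverse (S_ring n) {1..<k} {1..<k} (\<lambda>i q. S_class n (A i q)) B"
proof -
  define M where "M i q = (if i = q then 1 else 0) - A i q" for i q
  \<comment> \<open>This length forces \<open>n + 1\<close> factors of \<open>t\<close> on every walk, wherever it starts and ends.\<close>
  define N where "N = (n + 2) * k"
  define B where "B i j = (\<Sum>r<N. matrix_power {1..<k} M r i j)" for i j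
  have pow: "matrix_power {1..<k} M N i j \<in> S_ideal n" if "i \<in> {1..<k}" "j \<in> {1..<k}" for i j
    by (intro t_filtration_nilpotent matrix_power_filtration)
       (use that assms in \<open>auto simp: N_def M_def intro: t_filtration_0 t_filtration_add
          t_filtration_left t_filtration_mult S_ideal_subset_t_filtration S_ideal.zero_mem\<close>)
  have A: "A i q = (if i = q then 1 else 0) - M i q" for i q by (simp add: M_def)
  have delta: "S_class n ((if i = j then 1 else 0) - matrix_power {1..<k} M N i j)
      = (if i = j then \<one>\<^bsub>S_ring n\<^esub> else \<zero>\<^bsub>S_ring n\<^esub>)"
    if "i \<in> {1..<k}" "j \<in> {1..<k}" for i j
    using pow[OF that] S_ideal.uminus_mem[OF pow[OF that]]
    by (auto simp: S_class_eq_iff simp flip: S_class_one S_class_zero)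
  have "is_matrix_inverse (S_ring n) {1..<k} {1..<k} (\<lambda>i q. S_class n (A i q))
      (\<lambda>i q. S_class n (B i q))"
    unfolding is_matrix_inverse_def S_class_mult S_class_sum[OF finite_atLeastLessThan]
    using delta geometric_series_inverse[of "{1..<k}" _ _ M N] by (auto simp: A B_def)
  then show ?thesis by blast
qed

section \<open>Arcs and crossings\<close>

lemma velocity_add_int:
  assumes "closed_immersion \<gamma>"
  shows "velocity \<gamma> (x + of_int m) = velocity \<gamma> x"
proof -
  have "\<gamma> differentiable (at (x + of_int m))"
    using assms by (auto simp: closed_immersion_def C1_differentiable_on_eq)
  then have "(\<gamma> has_vector_derivative velocity \<gamma> (x + of_int m)) (at (x + of_int m))"
    unfolding velocity_def by (simp add: vector_derivative_works)
  moreover have "((\<lambda>y. y + of_int m) has_vector_derivative 1) (at x)"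
    by (auto intro!: derivative_eq_intros)
  ultimately have "(\<gamma> \<circ> (\<lambda>y. y + of_int m) has_vector_derivative
      1 *\<^sub>R velocity \<gamma> (x + of_int m)) (at x)"
    by (intro vector_diff_chain_at) auto
  moreover have "\<gamma> \<circ> (\<lambda>y. y + of_int m) = \<gamma>"
    using closed_immersion_add_int[OF assms] by auto
  ultimately show ?thesis
    unfolding velocity_def by (simp add: vector_derivative_at)
qed

lemma frac_add_floor: "frac x + of_int \<lfloor>x\<rfloor> = (x::real)"
  by (simp add: frac_def)

lemma closed_immersion_frac:
  assumes "closed_immersion \<gamma>"
  shows "\<gamma> (frac x) = \<gamma> x" "velocity \<gamma> (frac x) = velocity \<gamma> x"
  using closed_immersion_add_int[OF assms, of "frac x" "\<lfloor>x\<rfloor>"]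
    velocity_add_int[OF assms, of "frac x" "\<lfloor>x\<rfloor>"]
  by (simp_all add: frac_add_floor)

text \<open>
  If the initial point were not in the cut set, adding it to the arc would give a larger
  connected set avoiding the cut set.
\<close>

lemma arc_initial_point_in:
  assumes "arc_labelling \<gamma> V k c" "i \<in> {1..k}"
  shows "\<gamma> (c i) \<in> V"
proof (rule ccontr)
  assume nin: "\<gamma> (c i) \<notin> V"
  have lt: "c i < c (i + 1)" and comp: "{c i<..<c (i + 1)} \<in> components (UNIV - \<gamma> -` V)"
    using assms by (auto simp: arc_labelling_def)
  have closed_left: "{c i..<c (i + 1)} = insert (c i) {c i<..<c (i + 1)}" using lt by auto
  have "{c i<..<c (i + 1)} \<subseteq> UNIV - \<gamma> -` V" by (rule in_components_subset[OF comp])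
  then have "{c i..<c (i + 1)} \<subseteq> UNIV - \<gamma> -` V"
    using nin unfolding closed_left by simp
  moreover have "{c i<..<c (i + 1)} \<inter> {c i..<c (i + 1)} \<noteq> {}"
    using lt unfolding closed_left by simp
  ultimately have "{c i..<c (i + 1)} \<subseteq> {c i<..<c (i + 1)}"
    by (intro components_maximal[OF comp]) simp_all
  then show False unfolding closed_left by simp
qed

lemma arc_labelling_strict_mono:
  assumes "arc_labelling \<gamma> V k c" "1 \<le> i" "i < j" "j \<le> k + 1"
  shows "c i < c j"
  using assms(3,4)
proof (induction j)
  case (Suc j)
  have "c j < c (Suc j)" using assms(1,2) Suc.prems by (auto simp: arc_labelling_def)
  then show ?case using Suc by (cases "i = j") auto
qed simp

lemma arc_initial_point_frac_inj:
  assumes "arc_labelling \<gamma> V k c" "i \<in> {1..k}" "j \<in> {1..k}" "frac (c i) = frac (c j)"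
  shows "i = j"
proof (rule ccontr)
  assume "i \<noteq> j"
  have bounds: "c 1 \<le> c l" "c l < c 1 + 1" if "l \<in> {1..k}" for l
  proof -
    have "c l < c (k + 1)" using arc_labelling_strict_mono[OF assms(1), of l "k + 1"] that by simp
    moreover have "c (k + 1) = c 1 + 1" using assms(1) by (simp add: arc_labelling_def)
    ultimately show "c l < c 1 + 1" by simp
    show "c 1 \<le> c l"
      using arc_labelling_strict_mono[OF assms(1), of 1 l] that by (cases "l = 1") auto
  qed
  have "c i \<noteq> c j"
    using \<open>i \<noteq> j\<close> arc_labelling_strict_mono[OF assms(1), of i j]
      arc_labelling_strict_mono[OF assms(1), of j i] assms(2,3) by (cases "i < j") auto
  then show False
    using bij_betw_imp_inj_on[OF bij_betw_frac[of "c 1"]] bounds assms(2-4)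
    by (auto simp: inj_on_def)
qed

text \<open>
  The arcs cover one period up to their initial points, and they avoid the cut set. So the labelling
  lists every point of the circle that lies over \<open>V\<close>.
\<close>

lemma arc_initial_point_surj:
  assumes "closed_immersion \<gamma>" "arc_labelling \<gamma> V k c" "\<gamma> x \<in> V"
  shows "\<exists>i\<in>{1..k}. frac (c i) = frac x"
proof -
  define y where "y = x - of_int \<lfloor>x - c 1\<rfloor>"
  have y: "c 1 \<le> y" "y < c (k + 1)"
    using assms(2) unfolding y_def arc_labelling_def by linarith+
  define i where "i = Max {i \<in> {1..k}. c i \<le> y}"
  have k: "k \<ge> 1" using assms(2) by (simp add: arc_labelling_def)
  have i: "i \<in> {i \<in> {1..k}. c i \<le> y}"
    unfolding i_def by (rule Max_in) (use k y in auto)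
  have max: "j \<le> i" if "j \<in> {1..k}" "c j \<le> y" for j
    unfolding i_def using that by (intro Max_ge) auto
  have lt: "y < c (i + 1)"
    using y i max[of "i + 1"] by (cases "i = k") force+
  have "\<gamma> y = \<gamma> x"
    using closed_immersion_add_int[OF assms(1), of y "\<lfloor>x - c 1\<rfloor>"] by (simp add: y_def)
  moreover have "{c i<..<c (i + 1)} \<subseteq> UNIV - \<gamma> -` V"
    using assms(2) i by (intro in_components_subset) (auto simp: arc_labelling_def)
  ultimately have "y = c i" using assms(3) i lt by (force simp: less_eq_real_def)
  moreover have "frac x = frac y"
    using frac_add_of_int_right[of y "\<lfloor>x - c 1\<rfloor>"] by (simp add: y_def)
  ultimately have "frac (c i) = frac x" by simp
  then show ?thesis using i by auto
qed

lemma prev_arc_in: "i \<in> {1..k} \<Longrightarrow> prev_arc k i \<in> {1..k}"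
  by (auto simp: prev_arc_def)

lemma prev_arc_surj: "j \<in> {1..k} \<Longrightarrow> \<exists>i\<in>{1..k}. prev_arc k i = j"
  by (rule bexI[of _ "if j = k then 1 else j + 1"]) (auto simp: prev_arc_def)

lemma prev_arc_inj:
  "i \<in> {1..k} \<Longrightarrow> j \<in> {1..k} \<Longrightarrow> prev_arc k i = prev_arc k j \<Longrightarrow> i = j"
  by (auto simp: prev_arc_def split: if_splits)

lemma prev_arc_end:
  assumes "closed_immersion \<gamma>" "arc_labelling \<gamma> V k c" "i \<in> {1..k}"
  shows "\<gamma> (c (prev_arc k i + 1)) = \<gamma> (c i)"
    and "velocity \<gamma> (c (prev_arc k i + 1)) = velocity \<gamma> (c i)"
proof -
  have "c (prev_arc k i + 1) = c i + of_int (if i = 1 then 1 else 0)"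
    using assms(2,3) by (auto simp: prev_arc_def arc_labelling_def)
  then show "\<gamma> (c (prev_arc k i + 1)) = \<gamma> (c i)"
    "velocity \<gamma> (c (prev_arc k i + 1)) = velocity \<gamma> (c i)"
    using closed_immersion_add_int[OF assms(1)] velocity_add_int[OF assms(1)] by metis+
qed

text \<open>
  A flat crossing has exactly two preimages on the circle, and each of them is the initial point
  of exactly one arc.
\<close>

lemma crossing_partner_unique:
  assumes D: "flat_virtual_knot_diagram \<gamma> F" and L: "arc_labelling \<gamma> V k c" "F \<subseteq> V"
    and i: "i \<in> {1..k}" "\<gamma> (c i) \<in> F"
  shows "\<exists>!j. j \<in> {1..k} \<and> j \<noteq> i \<and> \<gamma> (c j) = \<gamma> (c i)"
proof -
  have gen: "generic_immersion \<gamma>" and mult: "\<gamma> (c i) \<in> multiple_points \<gamma>"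
    using D i by (auto simp: flat_virtual_knot_diagram_def)
  then have cl: "closed_immersion \<gamma>" and "card (circle_fibre \<gamma> (\<gamma> (c i))) = 2"
    by (auto simp: generic_immersion_def)
  then obtain x y where xy: "circle_fibre \<gamma> (\<gamma> (c i)) = {x, y}" "x \<noteq> y"
    by (auto simp: card_2_iff)
  have fibre: "frac (c j) \<in> {x, y}" if "\<gamma> (c j) = \<gamma> (c i)" for j
    using that closed_immersion_frac(1)[OF cl, of "c j"] frac_lt_1[of "c j"]
    unfolding xy(1)[symmetric] by (simp add: circle_fibre_def)
  define z where "z = (if frac (c i) = x then y else x)"
  have z: "z \<in> {x, y}" "z \<noteq> frac (c i)" "{x, y} = {frac (c i), z}"
    using fibre[of i] xy(2) by (auto simp: z_def)
  have zf: "\<gamma> z = \<gamma> (c i)" "frac z = z"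
    using z(1) unfolding xy(1)[symmetric] by (auto simp: circle_fibre_def frac_eq)
  then have "\<gamma> z \<in> V" using L(2) i(2) by auto
  from arc_initial_point_surj[OF cl L(1) this] obtain j
    where j: "j \<in> {1..k}" "frac (c j) = z" using zf by auto
  show ?thesis
  proof (rule ex1I[of _ j])
    show "j \<in> {1..k} \<and> j \<noteq> i \<and> \<gamma> (c j) = \<gamma> (c i)"
      using j z zf closed_immersion_frac(1)[OF cl, of "c j"] by auto
  next
    fix l assume l: "l \<in> {1..k} \<and> l \<noteq> i \<and> \<gamma> (c l) = \<gamma> (c i)"
    then have "frac (c l) = z"
      using fibre[of l] z(3) arc_initial_point_frac_inj[OF L(1), of l i] i by auto
    then show "l = j" using arc_initial_point_frac_inj[OF L(1), of l j] l j by auto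
  qed
qed

lemma crossing_arc_eq_prev_arc:
  assumes D: "flat_virtual_knot_diagram \<gamma> F" and L: "arc_labelling \<gamma> V k c" "F \<subseteq> V"
    and i: "i \<in> {1..k}" "\<gamma> (c i) \<in> F"
    and j: "j \<in> {1..k}" "j \<noteq> i" "\<gamma> (c j) = \<gamma> (c i)"
  shows "crossing_arc \<gamma> k c i = prev_arc k j"
  unfolding crossing_arc_def
proof (rule the_equality)
  have cl: "closed_immersion \<gamma>"
    using D by (simp add: flat_virtual_knot_diagram_def generic_immersion_def)
  show "prev_arc k j \<in> {1..k} \<and> prev_arc k j \<noteq> prev_arc k i
      \<and> \<gamma> (c (prev_arc k j + 1)) = \<gamma> (c i)"
    using i j prev_arc_in prev_arc_inj prev_arc_end(1)[OF cl L(1)] by metis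
  fix l assume l: "l \<in> {1..k} \<and> l \<noteq> prev_arc k i \<and> \<gamma> (c (l + 1)) = \<gamma> (c i)"
  then obtain l' where l': "l' \<in> {1..k}" "prev_arc k l' = l" using prev_arc_surj by blast
  then have "l' \<noteq> i" "\<gamma> (c l') = \<gamma> (c i)" using l prev_arc_end(1)[OF cl L(1)] by auto
  then show "l = prev_arc k j"
    using crossing_partner_unique[OF D L i] j l' by blast
qed

lemma positive_basis_swap:
  assumes "span {v, w} = (UNIV :: (real^2) set)"
  shows "positive_basis w v \<longleftrightarrow> \<not> positive_basis v w"
proof -
  have "det (vector [v, w] :: real^2^2) \<noteq> 0"
  proof -
    have "rows (vector [v, w] :: real^2^2) = range (\<lambda>i::2. (vector [v, w] :: real^2^2) $ i)"
      by (auto simp: rows_def row_def vec_lambda_eta)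
    then have "rows (vector [v, w] :: real^2^2) = {v, w}"
      by (simp add: UNIV_2)
    then show ?thesis
      using assms matrix_left_invertible_span_rows
      by (metis invertible_det_nz invertible_left_inverse)
  qed
  then show ?thesis by (auto simp: positive_basis_def det_2 vector_2 mult.commute)
qed

text \<open>The exponent of \<open>s\<close> in the coefficient \<open>x_i\<close> that joins arc \<open>i\<close> to its predecessor when \<open>t = 0\<close>.\<close>

definition strand_sign :: "(real \<Rightarrow> real^2) \<Rightarrow> (real^2) set \<Rightarrow> nat \<Rightarrow> (nat \<Rightarrow> real) \<Rightarrow> nat \<Rightarrow> int" where
  "strand_sign \<gamma> F k c i =
     (if \<gamma> (c i) \<notin> F then 0
      else if positive_basis (velocity \<gamma> (c (crossing_arc \<gamma> k c i + 1))) (velocity \<gamma> (c i))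
      then 1 else -1)"

text \<open>
  The two visits to a flat crossing see the same pair of velocities in opposite order, and
  transversality excludes a vanishing determinant.
\<close>

lemma strand_sign_partner:
  assumes D: "flat_virtual_knot_diagram \<gamma> F" and L: "arc_labelling \<gamma> V k c" "F \<subseteq> V"
    and i: "i \<in> {1..k}" "\<gamma> (c i) \<in> F"
    and j: "j \<in> {1..k}" "j \<noteq> i" "\<gamma> (c j) = \<gamma> (c i)"
  shows "strand_sign \<gamma> F k c j = - strand_sign \<gamma> F k c i"
proof -
  have gen: "generic_immersion \<gamma>" and mult: "\<gamma> (c i) \<in> multiple_points \<gamma>"
    using D i by (auto simp: flat_virtual_knot_diagram_def)
  then have cl: "closed_immersion \<gamma>" by (simp add: generic_immersion_def)
  have fibre: "frac (c i) \<in> circle_fibre \<gamma> (\<gamma> (c i))" "frac (c j) \<in> circle_fibre \<gamma> (\<gamma> (c i))"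
    using j closed_immersion_frac(1)[OF cl] by (auto simp: circle_fibre_def frac_lt_1)
  have "frac (c i) \<noteq> frac (c j)"
    using arc_initial_point_frac_inj[OF L(1) i(1) j(1)] j(2) by auto
  then have "span {velocity \<gamma> (frac (c i)), velocity \<gamma> (frac (c j))} = UNIV"
    using gen mult fibre unfolding generic_immersion_def by blast
  then have "span {velocity \<gamma> (c i), velocity \<gamma> (c j)} = UNIV"
    by (simp add: closed_immersion_frac(2)[OF cl])
  note swap = positive_basis_swap[OF this]
  have ci: "crossing_arc \<gamma> k c i = prev_arc k j"
    by (rule crossing_arc_eq_prev_arc[OF D L i j])
  have cj: "crossing_arc \<gamma> k c j = prev_arc k i"
    by (rule crossing_arc_eq_prev_arc[OF D L j(1)]) (use i j in auto)
  show ?thesis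
    using i j swap
    by (simp add: strand_sign_def ci cj prev_arc_end(2)[OF cl L(1)] del: add_Suc_right One_nat_def)
qed

text \<open>
  Exchanging the two visits to each flat crossing is an involution that negates the signs.
\<close>

lemma sum_strand_sign:
  assumes D: "flat_virtual_knot_diagram \<gamma> F" and L: "arc_labelling \<gamma> V k c" "F \<subseteq> V"
  shows "(\<Sum>i=1..k. strand_sign \<gamma> F k c i) = 0"
proof -
  define I where "I = {i \<in> {1..k}. \<gamma> (c i) \<in> F}"
  define partner where
    "partner i = (THE j. j \<in> {1..k} \<and> j \<noteq> i \<and> \<gamma> (c j) = \<gamma> (c i))" for i
  have partner: "partner i \<in> {1..k} \<and> partner i \<noteq> i \<and> \<gamma> (c (partner i)) = \<gamma> (c i)"
    if "i \<in> I" for i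
    unfolding partner_def
    by (rule theI') (use that crossing_partner_unique[OF D L] in \<open>auto simp: I_def\<close>)
  have partner_in: "partner i \<in> I" if "i \<in> I" for i
    using partner[OF that] that by (simp add: I_def)
  have invol: "partner (partner i) = i" if "i \<in> I" for i
    using partner[OF that] partner[OF partner_in[OF that]] that
      crossing_partner_unique[OF D L, of "partner i"] by (auto simp: I_def)
  have "sum (strand_sign \<gamma> F k c) I = (\<Sum>i\<in>I. strand_sign \<gamma> F k c (partner i))"
    by (rule sum.reindex_bij_witness[of _ partner partner]) (auto simp: invol partner_in)
  also have "\<dots> = (\<Sum>i\<in>I. - strand_sign \<gamma> F k c i)"
    using partner strand_sign_partner[OF D L] by (intro sum.cong) (auto simp: I_def)
  finally have "sum (strand_sign \<gamma> F k c) I = 0" by (simp add: sum_negf)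
  moreover have "sum (strand_sign \<gamma> F k c) {1..k} = sum (strand_sign \<gamma> F k c) I"
    by (rule sum.mono_neutral_right) (auto simp: I_def strand_sign_def)
  ultimately show ?thesis by simp
qed

section \<open>The coloring matrix over the free ring\<close>

definition free_coloring_matrix ::
    "(real \<Rightarrow> real^2) \<Rightarrow> (real^2) set \<Rightarrow> nat \<Rightarrow> (nat \<Rightarrow> real) \<Rightarrow> nat \<Rightarrow> nat \<Rightarrow> free_ring_elem" where
  "free_coloring_matrix \<gamma> F k c i q =
    (let e = (\<lambda>a. if a = q then 1 else 0); h = prev_arc k i; j = crossing_arc \<gamma> k c i
     in if \<gamma> (c i) \<in> F then
          if positive_basis (velocity \<gamma> (c (j + 1))) (velocity \<gamma> (c i))
          then e i - free_s * e h - free_t * e j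
          else e i - free_s_bar * (1 - free_t * free_t) * e h + free_s_bar * free_t * free_s * e j
        else e i - e h)"

lemma coloring_matrix_eq_S_class:
  "coloring_matrix n \<gamma> F k c i q = S_class n (free_coloring_matrix \<gamma> F k c i q)"
proof -
  have e: "(if b then S_class n 1 else S_class n 0) = S_class n (if b then 1 else 0)" for b
    by simp
  show ?thesis
    unfolding coloring_matrix_def free_coloring_matrix_def Let_def S_class_one[symmetric]
      S_class_zero[symmetric] e S_class_mult S_class_diff S_class_add
    by (simp only: if_distrib[of "S_class n"] cong: if_cong)
qed

text \<open>
  On or above the diagonal of the minor, the entry at the preceding arc does not occur: that arc
  has index \<open>i - 1\<close>, or the deleted index \<open>k\<close> when \<open>i = 1\<close>. What is left besides \<open>1\<close> is a multiple of \<open>t\<close>.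
\<close>

lemma free_coloring_matrix_upper:
  assumes "i \<in> {1..<k}" "q \<in> {1..<k}" "i \<le> q"
  shows "(if i = q then 1 else 0) - free_coloring_matrix \<gamma> F k c i q \<in> t_filtration n 1"
proof -
  define e :: "nat \<Rightarrow> free_ring_elem" where "e a = (if a = q then 1 else 0)" for a
  have h: "prev_arc k i \<noteq> q" using assms by (auto simp: prev_arc_def)
  have 0: "0 \<in> t_filtration n 1"
    by (intro S_ideal_subset_t_filtration S_ideal.zero_mem)
  have t: "free_t * e j \<in> t_filtration n 1" for j by (rule t_times_in_t_filtration)
  have "(- free_s_bar) * (free_t * (free_s * e j)) \<in> t_filtration n 1" for j
    by (intro t_filtration_left t_times_in_t_filtration)
  then have s: "- (free_s_bar * free_t * free_s * e j) \<in> t_filtration n 1" for j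
    by (simp add: mult.assoc)
  show ?thesis
    using h 0 t s unfolding free_coloring_matrix_def e_def Let_def by auto
qed

definition s_power :: "int \<Rightarrow> free_ring_elem" where
  "s_power z = (if z \<ge> 0 then free_s ^ nat z else free_s_bar ^ nat (- z))"

lemma s_times_s_power: "free_s * s_power z - s_power (z + 1) \<in> S_ideal n"
proof (cases "z \<ge> 0")
  case True
  then show ?thesis by (simp add: s_power_def nat_add_distrib S_ideal.zero_mem)
next
  case False
  then have n: "nat (- z) = Suc (nat (- (z + 1)))" by simp
  have "free_s * free_s_bar - 1 \<in> S_ideal n"
    using S_relators_in_ideal[of n] by (auto simp: S_relators_def)
  from S_ideal.right_mem[OF this, of "free_s_bar ^ nat (- (z + 1))"] show ?thesis
    using False n by (auto simp: s_power_def algebra_simps)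
qed

lemma s_bar_times_s_power: "free_s_bar * s_power z - s_power (z - 1) \<in> S_ideal n"
proof (cases "z \<le> 0")
  case True
  then have n: "nat (1 - z) = Suc (nat (- z))" by simp
  show ?thesis using True by (cases "z = 0") (auto simp: s_power_def n S_ideal.zero_mem)
next
  case False
  then have n: "nat z = Suc (nat (z - 1))" by simp
  have "free_s_bar * free_s - 1 \<in> S_ideal n"
    using S_relators_in_ideal[of n] by (auto simp: S_relators_def)
  from S_ideal.right_mem[OF this, of "free_s ^ nat (z - 1)"] show ?thesis
    using False n by (auto simp: s_power_def algebra_simps)
qed

text \<open>
  Modulo \<open>t\<close> the row of arc \<open>i\<close> says that the exponents of \<open>s\<close> at arcs \<open>i\<close> and \<open>i - 1\<close> differ by the sign of
  \<open>i\<close>, which holds for the partial sums of signs. Row \<open>1\<close> refers back to arc \<open>k\<close>, whose partial sum is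
  the total sum \<open>0\<close>, as the empty sum before arc \<open>1\<close> should be.
\<close>

lemma free_coloring_matrix_kernel:
  assumes D: "flat_virtual_knot_diagram \<gamma> F" and L: "arc_labelling \<gamma> V k c" "F \<subseteq> V"
    and i: "i \<in> {1..k}"
  shows "(\<Sum>q\<in>{1..k}. free_coloring_matrix \<gamma> F k c i q
      * s_power (\<Sum>l=1..q. strand_sign \<gamma> F k c l)) \<in> S_ideal 0"
proof -
  define v where "v q = s_power (\<Sum>l=1..q. strand_sign \<gamma> F k c l)" for q
  define h where "h = prev_arc k i"
  define j where "j = crossing_arc \<gamma> k c i"
  \<comment> \<open>The exponent at the preceding arc, written without a case distinction for \<open>i = 1\<close>.\<close>
  define z where "z = (\<Sum>l=1..i. strand_sign \<gamma> F k c l) - strand_sign \<gamma> F k c i"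
  define e :: "nat \<Rightarrow> nat \<Rightarrow> free_ring_elem" where "e a q = (if a = q then 1 else 0)" for a q
  define w where "w = (\<Sum>q\<in>{1..k}. e j q * v q)"
  have t: "free_t \<in> S_ideal 0"
    using S_relators_in_ideal[of 0] by (auto simp: S_relators_def)
  have e: "(\<Sum>q\<in>{1..k}. e a q * v q) = v a" if "a \<in> {1..k}" for a
    using that by (simp add: e_def if_distrib[of "\<lambda>x. x * _"] cong: if_cong)
  have h_in: "h \<in> {1..k}" unfolding h_def by (rule prev_arc_in[OF i])
  have vi: "v i = s_power (z + strand_sign \<gamma> F k c i)" by (simp add: v_def z_def)
  have vh: "v h = s_power z"
  proof (cases "i = 1")
    case True
    then show ?thesis
      using sum_strand_sign[OF D L] by (simp add: v_def h_def prev_arc_def z_def)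
  next
    case False
    then obtain i' where "i = Suc i'" "i' \<ge> 1" using i by (cases i) auto
    then show ?thesis by (simp add: v_def h_def prev_arc_def z_def)
  qed
  consider (fake) "\<gamma> (c i) \<notin> F"
    | (pos) "\<gamma> (c i) \<in> F" "positive_basis (velocity \<gamma> (c (j + 1))) (velocity \<gamma> (c i))"
    | (neg) "\<gamma> (c i) \<in> F" "\<not> positive_basis (velocity \<gamma> (c (j + 1))) (velocity \<gamma> (c i))"
    by blast
  then have "(\<Sum>q\<in>{1..k}. free_coloring_matrix \<gamma> F k c i q * v q) \<in> S_ideal 0"
  proof cases
    case fake
    then have row: "free_coloring_matrix \<gamma> F k c i q = e i q - e h q" for q
      by (simp add: free_coloring_matrix_def Let_def e_def h_def)
    have "(\<Sum>q\<in>{1..k}. free_coloring_matrix \<gamma> F k c i q * v q) = v i - v h"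
      by (simp add: row left_diff_distrib sum_subtractf e[OF i] e[OF h_in] del: One_nat_def)
    also have "v i = v h" using fake vi vh by (simp add: strand_sign_def)
    finally show ?thesis by (simp add: S_ideal.zero_mem)
  next
    case pos
    then have row: "free_coloring_matrix \<gamma> F k c i q = e i q - free_s * e h q - free_t * e j q" for q
      by (simp add: free_coloring_matrix_def Let_def e_def h_def j_def)
    have "(\<Sum>q\<in>{1..k}. free_coloring_matrix \<gamma> F k c i q * v q)
        = (v i - free_s * v h) - free_t * w"
      by (simp add: row left_diff_distrib sum_subtractf mult.assoc e[OF i] e[OF h_in] w_def
          del: One_nat_def flip: sum_distrib_left)
    moreover have "v i - free_s * v h \<in> S_ideal 0"
      using S_ideal.uminus_mem[OF s_times_s_power[of z 0]] pos vi vh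
      by (simp add: strand_sign_def j_def)
    ultimately show ?thesis
      using t by (simp add: S_ideal.diff_mem S_ideal.right_mem)
  next
    case neg
    then have row: "free_coloring_matrix \<gamma> F k c i q
        = e i q - free_s_bar * (1 - free_t * free_t) * e h q + free_s_bar * free_t * free_s * e j q" for q
      by (simp add: free_coloring_matrix_def Let_def e_def h_def j_def)
    have "(\<Sum>q\<in>{1..k}. free_coloring_matrix \<gamma> F k c i q * v q)
        = v i - free_s_bar * (1 - free_t * free_t) * v h + free_s_bar * free_t * free_s * w"
      by (simp only: row left_diff_distrib distrib_right sum_subtractf sum.distrib mult.assoc
          e[OF i] e[OF h_in] w_def flip: sum_distrib_left)
    also have "\<dots> = (v i - free_s_bar * v h) + free_s_bar * (free_t * (free_t * v h))
        + free_s_bar * (free_t * (free_s * w))"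
      by (simp add: algebra_simps)
    also have "\<dots> \<in> S_ideal 0"
    proof (intro S_ideal.add_mem S_ideal.left_mem[OF S_ideal.right_mem[OF t]])
      show "v i - free_s_bar * v h \<in> S_ideal 0"
        using S_ideal.uminus_mem[OF s_bar_times_s_power[of z 0]] neg vi vh
        by (simp add: strand_sign_def j_def)
    qed
    finally show ?thesis .
  qed
  then show ?thesis by (simp add: v_def)
qed

section \<open>The quasideterminant\<close>

theorem claim6p1:
  fixes n k :: nat
    and \<gamma> :: "real \<Rightarrow> real^2"
    and V_flat V_fake :: "(real^2) set"
    and c :: "nat \<Rightarrow> real"
  assumes "flat_virtual_knot_diagram \<gamma> V_flat"
    and "fake_vertices \<gamma> V_fake"
    and "V_flat \<union> V_fake \<noteq> {}"
    and "arc_labelling \<gamma> (V_flat \<union> V_fake) k c"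
  shows "\<exists>d \<in> carrier (S_ring n).
           quasideterminant (S_ring n) k (coloring_matrix n \<gamma> V_flat k c) k k = Some d \<and>
           S_proj n d = \<zero>\<^bsub>S_ring 0\<^esub>"
proof -
  define A where "A = free_coloring_matrix \<gamma> V_flat k c"
  define v where "v q = s_power (\<Sum>l=1..q. strand_sign \<gamma> V_flat k c l)" for q
  define K where "K = {1..<k}"
  have k: "k \<ge> 1" using assms(4) by (simp add: arc_labelling_def)
  have K: "{1..k} - {k} = K" "{1..k} = insert k K" "k \<notin> K" "finite K" using k by (auto simp: K_def)
  have col: "coloring_matrix n \<gamma> V_flat k c = (\<lambda>i q. S_class n (A i q))"
    by (intro ext) (simp add: A_def coloring_matrix_eq_S_class)
  have vk: "v k = 1"
    using sum_strand_sign[OF assms(1,4)] by (simp add: v_def s_power_def)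
  have kernel: "(\<Sum>q\<in>K. A p q * v q) + A p k \<in> S_ideal 0" if "p \<in> insert k K" for p
  proof -
    have "p \<in> {1..k}" using that K(2) by simp
    then have "(\<Sum>q\<in>{1..k}. A p q * v q) \<in> S_ideal 0"
      unfolding A_def v_def by (intro free_coloring_matrix_kernel[OF assms(1,4)]) auto
    then show ?thesis using K(3,4) vk by (simp add: K(2) add.commute del: One_nat_def)
  qed
  have "\<exists>b. (\<forall>q\<in>K. \<forall>q'\<in>K. (\<Sum>p\<in>K. b q p * A p q') - (if q = q' then 1 else 0) \<in> S_ideal n) \<and>
      quasideterminant (S_ring n) k (coloring_matrix n \<gamma> V_flat k c) k k
        = Some (S_class n (A k k - (\<Sum>q\<in>K. \<Sum>p\<in>K. A k q * b q p * A p k)))"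
  proof (cases "k = 1")
    case True
    then show ?thesis unfolding quasideterminant_def col by (simp add: K_def)
  next
    case False
    \<comment> \<open>The inverse chosen in the definition is lifted to the free ring entry by entry.\<close>
    define B where "B = (SOME B. is_matrix_inverse (S_ring n) K K (\<lambda>i q. S_class n (A i q)) B)"
    have ex: "\<exists>B. is_matrix_inverse (S_ring n) K K (\<lambda>i q. S_class n (A i q)) B"
      unfolding K_def A_def by (intro matrix_inverse_exists free_coloring_matrix_upper)
    then have B: "is_matrix_inverse (S_ring n) K K (\<lambda>i q. S_class n (A i q)) B"
      unfolding B_def by (rule someI_ex)
    then have "\<forall>q\<in>K. \<forall>p\<in>K. \<exists>x. B q p = S_class n x"
      unfolding is_matrix_inverse_def by (meson S_carrier_cases)
    then obtain b where b: "\<And>q p. q \<in> K \<Longrightarrow> p \<in> K \<Longrightarrow> B q p = S_class n (b q p)"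
      by metis
    have "S_class n (\<Sum>p\<in>K. b q p * A p q') = S_class n (if q = q' then 1 else 0)"
      if "q \<in> K" "q' \<in> K" for q q'
    proof -
      have "S_class n (\<Sum>p\<in>K. b q p * A p q')
          = (\<Oplus>\<^bsub>S_ring n\<^esub>p\<in>K. B q p \<otimes>\<^bsub>S_ring n\<^esub> S_class n (A p q'))"
        by (rule S_class_finsum[symmetric]) (use K b that in \<open>auto simp: S_class_mult\<close>)
      also have "\<dots> = S_class n (if q = q' then 1 else 0)"
        using B that by (simp add: is_matrix_inverse_def S_class_one S_class_zero)
      finally show ?thesis .
    qed
    then have "\<forall>q\<in>K. \<forall>q'\<in>K.
        (\<Sum>p\<in>K. b q p * A p q') - (if q = q' then 1 else 0) \<in> S_ideal n"
      by (simp add: S_class_eq_iff)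
    moreover have "(\<Oplus>\<^bsub>S_ring n\<^esub>q\<in>K. \<Oplus>\<^bsub>S_ring n\<^esub>p\<in>K.
        S_class n (A k q) \<otimes>\<^bsub>S_ring n\<^esub> B q p \<otimes>\<^bsub>S_ring n\<^esub> S_class n (A p k))
        = S_class n (\<Sum>q\<in>K. \<Sum>p\<in>K. A k q * b q p * A p k)"
      by (intro S_class_finsum) (use K b in \<open>auto simp: S_class_mult\<close>)
    then have "quasideterminant (S_ring n) k (coloring_matrix n \<gamma> V_flat k c) k k
        = Some (S_class n (A k k - (\<Sum>q\<in>K. \<Sum>p\<in>K. A k q * b q p * A p k)))"
      using False ex
      unfolding quasideterminant_def col K(1) Let_def B_def[symmetric]
      by (simp add: S_class_diff)
    ultimately show ?thesis by blast
  qed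
  then obtain b where
    b: "\<And>q q'. q \<in> K \<Longrightarrow> q' \<in> K \<Longrightarrow> (\<Sum>p\<in>K. b q p * A p q') - (if q = q' then 1 else 0) \<in> S_ideal n"
    and quasi: "quasideterminant (S_ring n) k (coloring_matrix n \<gamma> V_flat k c) k k
        = Some (S_class n (A k k - (\<Sum>q\<in>K. \<Sum>p\<in>K. A k q * b q p * A p k)))"
    by blast
  have "A k k - (\<Sum>q\<in>K. \<Sum>p\<in>K. A k q * b q p * A p k) \<in> S_ideal 0"
    using K(4) kernel subsetD[OF S_ideal_le_0 b] by (rule S_ideal.quasideterminant_mem)
  then have "S_proj n (S_class n (A k k - (\<Sum>q\<in>K. \<Sum>p\<in>K. A k q * b q p * A p k)))
      = \<zero>\<^bsub>S_ring 0\<^esub>"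
    by (simp add: S_proj_S_class S_class_eq_iff flip: S_class_zero)
  with quasi show ?thesis by (intro bexI[OF _ S_class_closed]) auto
qed

end
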